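(* Let $X$ be a surface of revolution in the Lorentz-Minkowski space $\mathbb R^4_1$ of hyperbolic type $[SR_3]$ or of elliptic type $[SR_4]$, with radius function $\rho>0$ on $I$, let $\varepsilon\in\{1,-1\}$ be the sign of $E=\langle X_u,X_u\rangle$, and let $C$ be a real constant. Then the Gaussian curvature $K$ of $X$ is identically equal to $C$ if and only if there are real constants $C_1,C_2$ such that for all $u\in I$ (1) $\rho(u)=C_1e^{\lambda u}+C_2e^{-\lambda u}$, when $\varepsilon C=-\lambda^2<0$; (2) $\rho(u)=C_1\sin(\lambda u)+C_2\cos(\lambda u)$, when $\varepsilon C=\lambda^2>0$; (3) $\rho(u)=C_1u+C_2$, when $C=0$; where in each case $C_1,C_2$ are such that $\rho(u)>0$ for $u\in I$, and $\lambda$ is a real constant.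
   Context: $I\subset\mathbb R$ is an open interval and all functions are smooth. $\mathbb R^4_1$ is $\mathbb R^4$ with the pseudo scalar product $\langle x,y\rangle=x_1y_1+x_2y_2+x_3y_3-x_4y_4$. A curve $z$ that is spacelike (respectively timelike) is parametrized by arc-length if $\langle z',z'\rangle=1$ (respectively $-1$). Type $[SR_3]$ (hyperbolic): $z(u)=(f(u),g(u),0,\rho(u))$, $u\in I$, $\rho(u)>0$, is a spacelike or timelike curve parametrized by arc-length, so $(f')^2+(g')^2-(\rho')^2=\varepsilon$, and $X(u,v)=(f(u),g(u),\rho(u)\sinh v,\rho(u)\cosh v)$, $u\in I$, $v\in\mathbb R$. Type $[SR_4]$ (elliptic): $z(u)=(\rho(u),0,f(u),g(u))$, $u\in I$, $\rho(u)>0$, is a spacelike or timelike curve parametrized by arc-length, so $(\rho')^2+(f')^2-(g')^2=\varepsilon$, and $X(u,v)=(\rho(u)\cos v,\rho(u)\sin v,f(u),g(u))$, $u\in I$, $v\in\mathbb R$. The Gaussian curvature is the sectional curvature of the induced (semi-Riemannian) metric. In orthogonal coordinates, with $E=\langle X_u,X_u\rangle$, $F=\langle X_u,X_v\rangle=0$, $G=\langle X_v,X_v\rangle$, $e=|E|^{1/2}$, $\gamma=|G|^{1/2}$, and $\varepsilon_1,\varepsilon_2$ the signs of $E,G$, it is $K=-\frac{1}{e\gamma}\left[\varepsilon_1\left(\frac{\gamma_u}{e}\right)_u+\varepsilon_2\left(\frac{e_v}{\gamma}\right)_v\right]$. *)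

theory Defs
  imports "HOL-Analysis.Analysis"
begin

definition smooth_real_on :: "real set \<Rightarrow> (real \<Rightarrow> real) \<Rightarrow> bool" where
  "smooth_real_on I f \<longleftrightarrow> (\<forall>n. \<forall>u\<in>I. (deriv ^^ n) f differentiable at u)"

definition lorentz :: "real^4 \<Rightarrow> real^4 \<Rightarrow> real" where
  "lorentz x y = x$1 * y$1 + x$2 * y$2 + x$3 * y$3 - x$4 * y$4"

text \<open>A curve that is spacelike (value 1) or timelike (value -1) on all of \<open>I\<close>
  and parametrized by arc-length.\<close>

definition arclength_parametrized :: "real set \<Rightarrow> (real \<Rightarrow> real^4) \<Rightarrow> bool" where
  "arclength_parametrized I z \<longleftrightarrow>
     (\<forall>u\<in>I. lorentz (vector_derivative z (at u)) (vector_derivative z (at u)) = 1) \<or>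
     (\<forall>u\<in>I. lorentz (vector_derivative z (at u)) (vector_derivative z (at u)) = -1)"

text \<open>The parameter pair \<open>(u, v)\<close> is the vector \<open>p :: real^2\<close> with
  \<open>p$1 = u\<close> and \<open>p$2 = v\<close>.\<close>

definition SR3_curve ::
    "(real \<Rightarrow> real) \<Rightarrow> (real \<Rightarrow> real) \<Rightarrow> (real \<Rightarrow> real) \<Rightarrow> real \<Rightarrow> real^4" where
  "SR3_curve f g \<rho> u = vector [f u, g u, 0, \<rho> u]"

definition SR3_surface ::
    "(real \<Rightarrow> real) \<Rightarrow> (real \<Rightarrow> real) \<Rightarrow> (real \<Rightarrow> real) \<Rightarrow> real^2 \<Rightarrow> real^4" where
  "SR3_surface f g \<rho> p =
     vector [f (p$1), g (p$1), \<rho> (p$1) * sinh (p$2), \<rho> (p$1) * cosh (p$2)]"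

definition SR4_curve ::
    "(real \<Rightarrow> real) \<Rightarrow> (real \<Rightarrow> real) \<Rightarrow> (real \<Rightarrow> real) \<Rightarrow> real \<Rightarrow> real^4" where
  "SR4_curve f g \<rho> u = vector [\<rho> u, 0, f u, g u]"

definition SR4_surface ::
    "(real \<Rightarrow> real) \<Rightarrow> (real \<Rightarrow> real) \<Rightarrow> (real \<Rightarrow> real) \<Rightarrow> real^2 \<Rightarrow> real^4" where
  "SR4_surface f g \<rho> p =
     vector [\<rho> (p$1) * cos (p$2), \<rho> (p$1) * sin (p$2), f (p$1), g (p$1)]"

definition partial_deriv ::
    "'n \<Rightarrow> (real^'n \<Rightarrow> 'a::real_normed_vector) \<Rightarrow> real^'n \<Rightarrow> 'a" where
  "partial_deriv i F p = vector_derivative (\<lambda>t. F (p + t *\<^sub>R axis i 1)) (at 0)"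

definition induced_metric :: "(real^'n \<Rightarrow> real^4) \<Rightarrow> real^'n \<Rightarrow> real^'n^'n" where
  "induced_metric X p = (\<chi> i j. lorentz (partial_deriv i X p) (partial_deriv j X p))"

text \<open>\<open>christoffel h k i j p\<close> is the Christoffel symbol \<open>\<Gamma>\<close> with upper index \<open>k\<close> and lower
  indices \<open>i, j\<close> of the Levi-Civita connection of the metric \<open>h\<close>.\<close>

definition christoffel ::
    "(real^'n \<Rightarrow> real^'n^'n) \<Rightarrow> 'n \<Rightarrow> 'n \<Rightarrow> 'n \<Rightarrow> real^'n \<Rightarrow> real" where
  "christoffel h k i j p =
     (\<Sum>l\<in>UNIV. matrix_inv (h p) $ k $ l *
        (partial_deriv i (\<lambda>q. h q $ j $ l) p + partial_deriv j (\<lambda>q. h q $ i $ l) p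
         - partial_deriv l (\<lambda>q. h q $ i $ j) p)) / 2"

text \<open>\<open>riemann h l k i j p\<close> is the component along the \<open>l\<close>-th coordinate field of
  \<open>R(\<partial>\<^sub>i, \<partial>\<^sub>j) \<partial>\<^sub>k\<close>, where \<open>R(V, W) = [\<nabla>\<^sub>V, \<nabla>\<^sub>W] - \<nabla>\<close> along \<open>[V, W]\<close>.\<close>

definition riemann ::
    "(real^'n \<Rightarrow> real^'n^'n) \<Rightarrow> 'n \<Rightarrow> 'n \<Rightarrow> 'n \<Rightarrow> 'n \<Rightarrow> real^'n \<Rightarrow> real" where
  "riemann h l k i j p =
     partial_deriv i (christoffel h l j k) p - partial_deriv j (christoffel h l i k) p
     + (\<Sum>m\<in>UNIV. christoffel h l i m p * christoffel h m j k p
                   - christoffel h l j m p * christoffel h m i k p)"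

text \<open>Sectional curvature of the plane spanned by the \<open>i\<close>-th and \<open>j\<close>-th coordinate fields:
  \<open>\<langle>R(\<partial>\<^sub>i, \<partial>\<^sub>j) \<partial>\<^sub>j, \<partial>\<^sub>i\<rangle>\<close> over the Gram determinant.\<close>

definition sectional_curvature ::
    "(real^'n \<Rightarrow> real^'n^'n) \<Rightarrow> 'n \<Rightarrow> 'n \<Rightarrow> real^'n \<Rightarrow> real" where
  "sectional_curvature h i j p =
     (\<Sum>l\<in>UNIV. h p $ l $ i * riemann h l j i j p)
       / (h p $ i $ i * h p $ j $ j - (h p $ i $ j)\<^sup>2)"

definition gaussian_curvature :: "(real^2 \<Rightarrow> real^4) \<Rightarrow> real^2 \<Rightarrow> real" where
  "gaussian_curvature X = sectional_curvature (induced_metric X) 1 2"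

end

theory Submission
  imports Defs
begin

text \<open>
  For both types the rotation acts by isometries, so the induced metric is
  \<open>\<epsilon> du\<^sup>2 + \<rho>(u)\<^sup>2 dv\<^sup>2\<close>: arc-length parametrization makes \<open>\<langle>X\<^sub>u, X\<^sub>u\<rangle>\<close>
  equal to its sign \<open>\<epsilon>\<close>, and the identities \<open>cosh\<^sup>2 - sinh\<^sup>2 = 1\<close> and \<open>cos\<^sup>2 + sin\<^sup>2 = 1\<close> give
  \<open>\<langle>X\<^sub>v, X\<^sub>v\<rangle> = \<rho>\<^sup>2\<close> (lemmas \<open>induced_metric_SR3\<close> and \<open>induced_metric_SR4\<close>). A metric
  \<open>e du\<^sup>2 + r(u)\<^sup>2 dv\<^sup>2\<close> with a constant \<open>e \<noteq> 0\<close> has sectional curvature \<open>- r'' / (e r)\<close>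
  (lemma \<open>sectional_curvature_warped\<close>), so the curvature of \<open>X\<close> is identically \<open>C\<close> if and only
  if \<open>\<rho>'' = - \<epsilon> C \<rho>\<close> on \<open>I\<close>.

  The solutions of this linear equation on an interval are found with first integrals. For
  \<open>y'' = k\<^sup>2 y\<close> the functions \<open>(y' \<plusminus> k y) e\<^bsup>\<minusplus>ku\<^esup>\<close> have derivative zero; for
  \<open>y'' = - k\<^sup>2 y\<close> the same holds for \<open>y' cos ku + k y sin ku\<close> and \<open>k y cos ku - y' sin ku\<close>; for
  \<open>y'' = 0\<close> it holds for \<open>y'\<close> and \<open>y - u y'\<close>. In each case \<open>y\<close> is a combination of the two
  constants thus obtained.
\<close>

section \<open>Derivatives along coordinate directions\<close>

lemma vec_has_vector_derivative:
  fixes F :: "real \<Rightarrow> real^'n"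
  assumes "\<And>i. ((\<lambda>t. F t $ i) has_real_derivative D $ i) (at t)"
  shows "(F has_vector_derivative D) (at t)"
  unfolding has_vector_derivative_def has_derivative_componentwise_within[of F]
  using assms
  by (auto simp: Basis_vec_def inner_axis has_real_derivative_iff_has_vector_derivative
      has_vector_derivative_def)

lemma vector_4_nth [simp]:
  "(vector [a, b, c, d] :: 'a::zero^4) $ 1 = a"
  "(vector [a, b, c, d] :: 'a::zero^4) $ 2 = b"
  "(vector [a, b, c, d] :: 'a::zero^4) $ 3 = c"
  "(vector [a, b, c, d] :: 'a::zero^4) $ 4 = d"
  by (simp_all add: vector_def)

lemma vec4_has_vector_derivative:
  fixes a b c d :: "real \<Rightarrow> real"
  assumes "(a has_real_derivative a') (at t)" "(b has_real_derivative b') (at t)"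
    "(c has_real_derivative c') (at t)" "(d has_real_derivative d') (at t)"
  shows "((\<lambda>t. vector [a t, b t, c t, d t] :: real^4) has_vector_derivative
           vector [a', b', c', d']) (at t)"
proof (rule vec_has_vector_derivative)
  have "\<forall>i. ((\<lambda>t. (vector [a t, b t, c t, d t] :: real^4) $ i) has_real_derivative
          (vector [a', b', c', d'] :: real^4) $ i) (at t)"
    unfolding forall_4 using assms by simp
  then show "((\<lambda>t. (vector [a t, b t, c t, d t] :: real^4) $ i) has_real_derivative
          (vector [a', b', c', d'] :: real^4) $ i) (at t)" for i
    by blast
qed

text \<open>Only the values of \<open>F\<close> over the strip \<open>I \<times> \<real>\<close> matter for its partial derivatives there, so
  a formula for \<open>F\<close> that is known on the strip alone may be differentiated.\<close>

lemma partial_deriv_strip: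
  fixes F :: "real^2 \<Rightarrow> real"
  assumes "open I" and "p $ 1 \<in> I"
    and F: "\<And>q. q $ 1 \<in> I \<Longrightarrow> F q = \<phi> (q $ 1)"
    and d: "(\<phi> has_real_derivative d) (at (p $ 1))"
  shows "partial_deriv 1 F p = d" and "partial_deriv 2 F p = 0"
proof -
  have "\<forall>\<^sub>F t in nhds 0. p $ 1 + t \<in> I"
  proof -
    have "open ((\<lambda>t. p $ 1 + t) -` I)"
      using \<open>open I\<close> by (intro open_vimage) (auto intro!: continuous_intros)
    then show ?thesis
      using \<open>p $ 1 \<in> I\<close> by (auto dest: eventually_nhds_in_open[of _ 0])
  qed
  then have ev: "\<forall>\<^sub>F t in nhds 0. F (p + t *\<^sub>R axis 1 1) = \<phi> (p $ 1 + t)"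
    by eventually_elim (simp add: F axis_def)
  have "((\<lambda>t. \<phi> (p $ 1 + t)) has_real_derivative d) (at 0)"
    using d DERIV_shift[of \<phi> d 0 "p $ 1"] by (simp add: add.commute)
  then have "((\<lambda>t. F (p + t *\<^sub>R axis 1 1)) has_real_derivative d) (at 0)"
    using DERIV_cong_ev[OF refl ev refl] by blast
  then show "partial_deriv 1 F p = d"
    unfolding partial_deriv_def
    by (intro vector_derivative_at) (simp add: has_real_derivative_iff_has_vector_derivative)
  show "partial_deriv 2 F p = 0"
    unfolding partial_deriv_def using F \<open>p $ 1 \<in> I\<close>
    by (intro vector_derivative_at) (simp add: axis_def)
qed

lemma smooth_real_on_DERIV:
  assumes "smooth_real_on I f" "u \<in> I"
  shows "(f has_real_derivative deriv f u) (at u)"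
    and "(deriv f has_real_derivative deriv (deriv f) u) (at u)"
proof -
  have d: "(deriv ^^ n) f differentiable at u" for n
    using assms by (auto simp: smooth_real_on_def)
  show "(f has_real_derivative deriv f u) (at u)"
    using d[of 0] by (simp add: DERIV_deriv_iff_real_differentiable)
  show "(deriv f has_real_derivative deriv (deriv f) u) (at u)"
    using d[of 1] by (simp add: DERIV_deriv_iff_real_differentiable)
qed

section \<open>Curvature of a warped metric\<close>

text \<open>The diagonal matrix with entries \<open>a\<close> and \<open>b\<close>.\<close>

definition diag2 :: "real \<Rightarrow> real \<Rightarrow> real^2^2" where
  "diag2 a b = (\<chi> i j. if i = j then (if i = 1 then a else b) else 0)"

lemma diag2_nth [simp]:
  "diag2 a b $ 1 $ 1 = a" "diag2 a b $ 2 $ 2 = b"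
  "diag2 a b $ 1 $ 2 = 0" "diag2 a b $ 2 $ 1 = 0"
  by (simp_all add: diag2_def)

lemma matrix_inv_diag2:
  assumes "a \<noteq> 0" "b \<noteq> 0"
  shows "matrix_inv (diag2 a b) = diag2 (1 / a) (1 / b)"
proof -
  let ?A = "diag2 a b" and ?B = "diag2 (1 / a) (1 / b)"
  have AB: "?A ** ?B = mat 1" "?B ** ?A = mat 1"
    using assms by (simp_all add: vec_eq_iff forall_2 matrix_matrix_mult_def sum_2 mat_def)
  then have "?A ** matrix_inv ?A = mat 1 \<and> matrix_inv ?A ** ?A = mat 1"
    unfolding matrix_inv_def by (rule someI[of _ ?B, OF conjI])
  then have "matrix_inv ?A = (?B ** ?A) ** matrix_inv ?A" and "?A ** matrix_inv ?A = mat 1"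
    by (simp_all add: AB)
  then show ?thesis
    by (simp flip: matrix_mul_assoc)
qed

text \<open>The metric \<open>e du\<^sup>2 + r(u)\<^sup>2 dv\<^sup>2\<close> on the strip over \<open>I\<close>. Its only nonzero Christoffel symbols
  are \<open>\<Gamma>\<^sup>1\<^sub>2\<^sub>2 = - r r' / e\<close> and \<open>\<Gamma>\<^sup>2\<^sub>1\<^sub>2 = \<Gamma>\<^sup>2\<^sub>2\<^sub>1 = r' / r\<close>.\<close>

lemma sectional_curvature_warped:
  fixes h :: "real^2 \<Rightarrow> real^2^2" and r r' r'' :: "real \<Rightarrow> real"
  assumes "open I" and e: "e \<noteq> 0"
    and h: "\<And>q. q $ 1 \<in> I \<Longrightarrow> h q = diag2 e ((r (q $ 1))\<^sup>2)"
    and r0: "\<And>u. u \<in> I \<Longrightarrow> r u \<noteq> 0"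
    and r': "\<And>u. u \<in> I \<Longrightarrow> (r has_real_derivative r' u) (at u)"
    and r'': "\<And>u. u \<in> I \<Longrightarrow> (r' has_real_derivative r'' u) (at u)"
    and p: "p $ 1 \<in> I"
  shows "sectional_curvature h 1 2 p = - r'' (p $ 1) / (e * r (p $ 1))"
proof -
  have dh: "partial_deriv 1 (\<lambda>q. h q $ 1 $ 1) q = 0" "partial_deriv 2 (\<lambda>q. h q $ 1 $ 1) q = 0"
    "partial_deriv 1 (\<lambda>q. h q $ 1 $ 2) q = 0" "partial_deriv 2 (\<lambda>q. h q $ 1 $ 2) q = 0"
    "partial_deriv 1 (\<lambda>q. h q $ 2 $ 1) q = 0" "partial_deriv 2 (\<lambda>q. h q $ 2 $ 1) q = 0"
    "partial_deriv 1 (\<lambda>q. h q $ 2 $ 2) q = 2 * r (q $ 1) * r' (q $ 1)"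
    "partial_deriv 2 (\<lambda>q. h q $ 2 $ 2) q = 0"
    if q: "q $ 1 \<in> I" for q
  proof -
    have sq: "((\<lambda>u. (r u)\<^sup>2) has_real_derivative 2 * r (q $ 1) * r' (q $ 1)) (at (q $ 1))"
      using r'[OF q] by (auto intro!: derivative_eq_intros)
    note D = partial_deriv_strip[OF \<open>open I\<close> q]
    show "partial_deriv 1 (\<lambda>q. h q $ 1 $ 1) q = 0" "partial_deriv 2 (\<lambda>q. h q $ 1 $ 1) q = 0"
      by (rule D[where \<phi> = "\<lambda>_. e" and d = 0]; simp add: h)+
    show "partial_deriv 1 (\<lambda>q. h q $ 1 $ 2) q = 0" "partial_deriv 2 (\<lambda>q. h q $ 1 $ 2) q = 0"
      "partial_deriv 1 (\<lambda>q. h q $ 2 $ 1) q = 0" "partial_deriv 2 (\<lambda>q. h q $ 2 $ 1) q = 0"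
      by (rule D[where \<phi> = "\<lambda>_. 0" and d = 0]; simp add: h)+
    show "partial_deriv 1 (\<lambda>q. h q $ 2 $ 2) q = 2 * r (q $ 1) * r' (q $ 1)"
      "partial_deriv 2 (\<lambda>q. h q $ 2 $ 2) q = 0"
      by (rule D[OF _ sq]; simp add: h)+
  qed
  have \<Gamma>: "christoffel h 1 1 1 q = 0" "christoffel h 1 1 2 q = 0" "christoffel h 1 2 1 q = 0"
    "christoffel h 1 2 2 q = - r (q $ 1) * r' (q $ 1) / e"
    "christoffel h 2 1 1 q = 0" "christoffel h 2 2 2 q = 0"
    "christoffel h 2 1 2 q = r' (q $ 1) / r (q $ 1)"
    "christoffel h 2 2 1 q = r' (q $ 1) / r (q $ 1)"
    if q: "q $ 1 \<in> I" for q
    using r0[OF q] e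
    by (simp_all add: christoffel_def sum_2 dh[OF q] h[OF q] matrix_inv_diag2 power2_eq_square)
  have "((\<lambda>u. - r u * r' u / e) has_real_derivative
      - ((r' (p $ 1))\<^sup>2 + r (p $ 1) * r'' (p $ 1)) / e) (at (p $ 1))"
    using e by (auto intro!: derivative_eq_intros r'[OF p] r''[OF p]
        simp: power2_eq_square field_simps)
  note d\<Gamma>122 = partial_deriv_strip(1)[OF \<open>open I\<close> p \<Gamma>(4) this]
  have d\<Gamma>112: "partial_deriv 2 (christoffel h 1 1 2) p = 0"
    by (rule partial_deriv_strip(2)[OF \<open>open I\<close> p, where \<phi> = "\<lambda>_. 0" and d = 0])
      (simp_all add: \<Gamma>)
  have "riemann h 1 2 1 2 p = - r (p $ 1) * r'' (p $ 1) / e"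
    using r0[OF p] e
    by (simp add: riemann_def sum_2 \<Gamma>[OF p] d\<Gamma>122 d\<Gamma>112 power2_eq_square field_simps)
  then show ?thesis
    using r0[OF p] e
    by (simp add: sectional_curvature_def sum_2 h[OF p] power2_eq_square field_simps)
qed

section \<open>The induced metric of surfaces of revolution\<close>

lemma axis2_nth [simp]:
  "(axis 1 c :: real^2) $ 1 = c" "(axis 1 c :: real^2) $ 2 = 0"
  "(axis 2 c :: real^2) $ 1 = 0" "(axis 2 c :: real^2) $ 2 = c"
  by (simp_all add: axis_def)

lemma DERIV_at_shifted:
  assumes "(f has_real_derivative d) (at u)"
  shows "((\<lambda>t. f (u + t)) has_real_derivative d) (at 0)"
  using assms DERIV_shift[of f d 0 u] by (simp add: add.commute)

text \<open>The metric is diagonal and does not depend on \<open>v\<close>; its first entry \<open>\<langle>X\<^sub>u, X\<^sub>u\<rangle>\<close> is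
  \<open>\<langle>z', z'\<rangle>\<close> for the profile curve \<open>z\<close>, because \<open>X\<^sub>u\<close> is the image of \<open>z'\<close> under a Lorentz
  rotation.\<close>

lemma induced_metric_SR3:
  assumes f: "(f has_real_derivative f') (at (p $ 1))"
    and g: "(g has_real_derivative g') (at (p $ 1))"
    and \<rho>: "(\<rho> has_real_derivative \<rho>') (at (p $ 1))"
  defines "z' \<equiv> vector_derivative (SR3_curve f g \<rho>) (at (p $ 1))"
  shows "induced_metric (SR3_surface f g \<rho>) p = diag2 (lorentz z' z') ((\<rho> (p $ 1))\<^sup>2)"
proof -
  note sh = f[THEN DERIV_at_shifted] g[THEN DERIV_at_shifted] \<rho>[THEN DERIV_at_shifted]
  have z': "z' = vector [f', g', 0, \<rho>']"
    unfolding z'_def SR3_curve_def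
    by (intro vector_derivative_at vec4_has_vector_derivative f g \<rho> DERIV_const)
  have "(\<lambda>t. SR3_surface f g \<rho> (p + t *\<^sub>R axis 1 1)) =
      (\<lambda>t. vector [f (p $ 1 + t), g (p $ 1 + t),
        \<rho> (p $ 1 + t) * sinh (p $ 2), \<rho> (p $ 1 + t) * cosh (p $ 2)])"
    by (simp add: SR3_surface_def)
  then have Xu: "partial_deriv 1 (SR3_surface f g \<rho>) p =
      vector [f', g', \<rho>' * sinh (p $ 2), \<rho>' * cosh (p $ 2)]"
    unfolding partial_deriv_def
    by (simp, intro vector_derivative_at vec4_has_vector_derivative sh DERIV_cmult_right)
  have "(\<lambda>t. SR3_surface f g \<rho> (p + t *\<^sub>R axis 2 1)) =
      (\<lambda>t. vector [f (p $ 1), g (p $ 1),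
        \<rho> (p $ 1) * sinh (p $ 2 + t), \<rho> (p $ 1) * cosh (p $ 2 + t)])"
    by (simp add: SR3_surface_def)
  then have Xv: "partial_deriv 2 (SR3_surface f g \<rho>) p =
      vector [0, 0, \<rho> (p $ 1) * cosh (p $ 2), \<rho> (p $ 1) * sinh (p $ 2)]"
    unfolding partial_deriv_def
    by (simp, intro vector_derivative_at vec4_has_vector_derivative DERIV_const)
      (auto intro!: derivative_eq_intros)
  have "(cosh (p $ 2))\<^sup>2 = 1 + (sinh (p $ 2))\<^sup>2"
    using hyperbolic_pythagoras[of "p $ 2"] by simp
  then have "cosh (p $ 2) * cosh (p $ 2) = 1 + sinh (p $ 2) * sinh (p $ 2)"
    by (simp add: power2_eq_square)
  then show ?thesis
    by (simp add: vec_eq_iff forall_2 induced_metric_def Xu Xv z' lorentz_def power2_eq_square)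
      algebra
qed

lemma induced_metric_SR4:
  assumes f: "(f has_real_derivative f') (at (p $ 1))"
    and g: "(g has_real_derivative g') (at (p $ 1))"
    and \<rho>: "(\<rho> has_real_derivative \<rho>') (at (p $ 1))"
  defines "z' \<equiv> vector_derivative (SR4_curve f g \<rho>) (at (p $ 1))"
  shows "induced_metric (SR4_surface f g \<rho>) p = diag2 (lorentz z' z') ((\<rho> (p $ 1))\<^sup>2)"
proof -
  note sh = f[THEN DERIV_at_shifted] g[THEN DERIV_at_shifted] \<rho>[THEN DERIV_at_shifted]
  have z': "z' = vector [\<rho>', 0, f', g']"
    unfolding z'_def SR4_curve_def
    by (intro vector_derivative_at vec4_has_vector_derivative f g \<rho> DERIV_const)
  have "(\<lambda>t. SR4_surface f g \<rho> (p + t *\<^sub>R axis 1 1)) =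
      (\<lambda>t. vector [\<rho> (p $ 1 + t) * cos (p $ 2), \<rho> (p $ 1 + t) * sin (p $ 2),
        f (p $ 1 + t), g (p $ 1 + t)])"
    by (simp add: SR4_surface_def)
  then have Xu: "partial_deriv 1 (SR4_surface f g \<rho>) p =
      vector [\<rho>' * cos (p $ 2), \<rho>' * sin (p $ 2), f', g']"
    unfolding partial_deriv_def
    by (simp, intro vector_derivative_at vec4_has_vector_derivative sh DERIV_cmult_right)
  have "(\<lambda>t. SR4_surface f g \<rho> (p + t *\<^sub>R axis 2 1)) =
      (\<lambda>t. vector [\<rho> (p $ 1) * cos (p $ 2 + t), \<rho> (p $ 1) * sin (p $ 2 + t),
        f (p $ 1), g (p $ 1)])"
    by (simp add: SR4_surface_def)
  then have Xv: "partial_deriv 2 (SR4_surface f g \<rho>) p =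
      vector [- \<rho> (p $ 1) * sin (p $ 2), \<rho> (p $ 1) * cos (p $ 2), 0, 0]"
    unfolding partial_deriv_def
    by (simp, intro vector_derivative_at vec4_has_vector_derivative DERIV_const)
      (auto intro!: derivative_eq_intros)
  have "cos (p $ 2) * cos (p $ 2) = 1 - sin (p $ 2) * sin (p $ 2)"
    using sin_cos_squared_add[of "p $ 2"] by (simp add: power2_eq_square)
  then show ?thesis
    by (simp add: vec_eq_iff forall_2 induced_metric_def Xu Xv z' lorentz_def power2_eq_square)
      algebra
qed

section \<open>Second order linear equations with constant coefficients\<close>

lemma DERIV_zero_constant_on_interval:
  fixes y :: "real \<Rightarrow> real"
  assumes "is_interval I" "\<And>u. u \<in> I \<Longrightarrow> (y has_real_derivative 0) (at u)"
  shows "\<exists>c. \<forall>u\<in>I. y u = c"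
  using assms by (intro has_field_derivative_zero_constant)
    (auto simp: is_interval_convex intro: has_field_derivative_at_within)

lemma second_derivative_unique:
  fixes y z :: "real \<Rightarrow> real"
  assumes "open I" and eq: "\<And>u. u \<in> I \<Longrightarrow> y u = z u"
    and y': "\<And>u. u \<in> I \<Longrightarrow> (y has_real_derivative y' u) (at u)"
    and y'': "\<And>u. u \<in> I \<Longrightarrow> (y' has_real_derivative y'' u) (at u)"
    and z': "\<And>u. u \<in> I \<Longrightarrow> (z has_real_derivative z' u) (at u)"
    and z'': "\<And>u. u \<in> I \<Longrightarrow> (z' has_real_derivative z'' u) (at u)"
    and u: "u \<in> I"
  shows "y'' u = z'' u"
proof -
  have "y' t = z' t" if "t \<in> I" for t
    using has_field_derivative_transform_within_open[OF z'[OF that] \<open>open I\<close> that eq[symmetric]]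
      y'[OF that] DERIV_unique by blast
  then show ?thesis
    using has_field_derivative_transform_within_open[OF z''[OF u] \<open>open I\<close> u, of y']
      y''[OF u] DERIV_unique by simp blast
qed

lemma ode_exp_iff:
  fixes k :: real
  assumes I: "open I" "is_interval I" and k: "k \<noteq> 0"
    and y': "\<And>u. u \<in> I \<Longrightarrow> (y has_real_derivative y' u) (at u)"
    and y'': "\<And>u. u \<in> I \<Longrightarrow> (y' has_real_derivative y'' u) (at u)"
  shows "(\<forall>u\<in>I. y'' u = k\<^sup>2 * y u) \<longleftrightarrow>
    (\<exists>C1 C2. \<forall>u\<in>I. y u = C1 * exp (k * u) + C2 * exp (- k * u))" (is "?L \<longleftrightarrow> ?R")
proof
  assume L: ?L
  have "\<exists>c. \<forall>u\<in>I. (y' u + k * y u) * exp (- k * u) = c"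
  proof (rule DERIV_zero_constant_on_interval[OF I(2)])
    show "((\<lambda>u. (y' u + k * y u) * exp (- k * u)) has_real_derivative 0) (at u)"
      if "u \<in> I" for u
      using L that by (auto intro!: derivative_eq_intros y'[OF that] y''[OF that]
          simp: algebra_simps power2_eq_square)
  qed
  then obtain A where A: "\<And>u. u \<in> I \<Longrightarrow> (y' u + k * y u) * exp (- k * u) = A"
    by blast
  have "\<exists>c. \<forall>u\<in>I. (y' u - k * y u) * exp (k * u) = c"
  proof (rule DERIV_zero_constant_on_interval[OF I(2)])
    show "((\<lambda>u. (y' u - k * y u) * exp (k * u)) has_real_derivative 0) (at u)"
      if "u \<in> I" for u
      using L that by (auto intro!: derivative_eq_intros y'[OF that] y''[OF that]
          simp: algebra_simps power2_eq_square)
  qed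
  then obtain B where B: "\<And>u. u \<in> I \<Longrightarrow> (y' u - k * y u) * exp (k * u) = B"
    by blast
  \<comment> \<open>Eliminate \<open>y'\<close> by subtracting the two first integrals.\<close>
  have "y u = (A / (2 * k)) * exp (k * u) + (- B / (2 * k)) * exp (- k * u)" if "u \<in> I" for u
    unfolding A[OF that, symmetric] B[OF that, symmetric]
    using k by (simp add: exp_minus field_simps)
  then show ?R by blast
next
  assume ?R
  then obtain C1 C2 where eq: "\<And>u. u \<in> I \<Longrightarrow> y u = C1 * exp (k * u) + C2 * exp (- k * u)"
    by blast
  show ?L
  proof
    fix u assume u: "u \<in> I"
    have "y'' u = C1 * exp (k * u) * k\<^sup>2 + C2 * exp (- k * u) * k\<^sup>2"
      by (rule second_derivative_unique[OF I(1) eq y' y'' _ _ u,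
            where z' = "\<lambda>u. C1 * exp (k * u) * k - C2 * exp (- k * u) * k"])
        (auto intro!: derivative_eq_intros simp: power2_eq_square)
    then show "y'' u = k\<^sup>2 * y u"
      by (simp add: eq[OF u] algebra_simps)
  qed
qed

lemma ode_sin_cos_iff:
  fixes k :: real
  assumes I: "open I" "is_interval I" and k: "k \<noteq> 0"
    and y': "\<And>u. u \<in> I \<Longrightarrow> (y has_real_derivative y' u) (at u)"
    and y'': "\<And>u. u \<in> I \<Longrightarrow> (y' has_real_derivative y'' u) (at u)"
  shows "(\<forall>u\<in>I. y'' u = - k\<^sup>2 * y u) \<longleftrightarrow>
    (\<exists>C1 C2. \<forall>u\<in>I. y u = C1 * sin (k * u) + C2 * cos (k * u))" (is "?L \<longleftrightarrow> ?R")
proof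
  assume L: ?L
  have "\<exists>c. \<forall>u\<in>I. y' u * cos (k * u) + k * y u * sin (k * u) = c"
  proof (rule DERIV_zero_constant_on_interval[OF I(2)])
    show "((\<lambda>u. y' u * cos (k * u) + k * y u * sin (k * u)) has_real_derivative 0) (at u)"
      if "u \<in> I" for u
      using L that by (auto intro!: derivative_eq_intros y'[OF that] y''[OF that]
          simp: algebra_simps power2_eq_square)
  qed
  then obtain A where A: "\<And>u. u \<in> I \<Longrightarrow> y' u * cos (k * u) + k * y u * sin (k * u) = A"
    by blast
  have "\<exists>c. \<forall>u\<in>I. k * y u * cos (k * u) - y' u * sin (k * u) = c"
  proof (rule DERIV_zero_constant_on_interval[OF I(2)])
    show "((\<lambda>u. k * y u * cos (k * u) - y' u * sin (k * u)) has_real_derivative 0) (at u)"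
      if "u \<in> I" for u
      using L that by (auto intro!: derivative_eq_intros y'[OF that] y''[OF that]
          simp: algebra_simps power2_eq_square)
  qed
  then obtain B where B: "\<And>u. u \<in> I \<Longrightarrow> k * y u * cos (k * u) - y' u * sin (k * u) = B"
    by blast
  have "y u = (A / k) * sin (k * u) + (B / k) * cos (k * u)" if "u \<in> I" for u
  proof -
    have "A * sin (k * u) + B * cos (k * u) =
        k * y u * ((sin (k * u))\<^sup>2 + (cos (k * u))\<^sup>2)"
      unfolding A[OF that, symmetric] B[OF that, symmetric] by algebra
    then show ?thesis using k by (simp add: field_simps)
  qed
  then show ?R by blast
next
  assume ?R
  then obtain C1 C2 where eq: "\<And>u. u \<in> I \<Longrightarrow> y u = C1 * sin (k * u) + C2 * cos (k * u)"
    by blast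
  show ?L
  proof
    fix u assume u: "u \<in> I"
    have "y'' u = - C1 * sin (k * u) * k\<^sup>2 - C2 * cos (k * u) * k\<^sup>2"
      by (rule second_derivative_unique[OF I(1) eq y' y'' _ _ u,
            where z' = "\<lambda>u. C1 * cos (k * u) * k - C2 * sin (k * u) * k"])
        (auto intro!: derivative_eq_intros simp: power2_eq_square)
    then show "y'' u = - k\<^sup>2 * y u"
      by (simp add: eq[OF u] algebra_simps)
  qed
qed

lemma ode_affine_iff:
  assumes I: "open I" "is_interval I"
    and y': "\<And>u. u \<in> I \<Longrightarrow> (y has_real_derivative y' u) (at u)"
    and y'': "\<And>u. u \<in> I \<Longrightarrow> (y' has_real_derivative y'' u) (at u)"
  shows "(\<forall>u\<in>I. y'' u = 0) \<longleftrightarrow> (\<exists>C1 C2. \<forall>u\<in>I. y u = C1 * u + C2)" (is "?L \<longleftrightarrow> ?R")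
proof
  assume L: ?L
  obtain A where A: "\<And>u. u \<in> I \<Longrightarrow> y' u = A"
    using DERIV_zero_constant_on_interval[OF I(2), of y'] y'' L by fastforce
  have "\<exists>c. \<forall>u\<in>I. y u - u * y' u = c"
  proof (rule DERIV_zero_constant_on_interval[OF I(2)])
    show "((\<lambda>u. y u - u * y' u) has_real_derivative 0) (at u)" if "u \<in> I" for u
      using L that by (auto intro!: derivative_eq_intros y'[OF that] y''[OF that])
  qed
  then obtain B where B: "\<And>u. u \<in> I \<Longrightarrow> y u - u * y' u = B"
    by blast
  have "y u = A * u + B" if "u \<in> I" for u
    using A[OF that] B[OF that] by (simp add: algebra_simps)
  then show ?R by blast
next
  assume ?R
  then obtain C1 C2 where eq: "\<And>u. u \<in> I \<Longrightarrow> y u = C1 * u + C2"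
    by blast
  show ?L
  proof
    fix u assume u: "u \<in> I"
    show "y'' u = 0"
      by (rule second_derivative_unique[OF I(1) eq y' y'' _ _ u, where z' = "\<lambda>u. C1"])
        (auto intro!: derivative_eq_intros)
  qed
qed

section \<open>Surfaces of revolution of constant curvature\<close>

theorem theorem3p2:
  fixes I :: "real set" and f g \<rho> :: "real \<Rightarrow> real"
    and X :: "real^2 \<Rightarrow> real^4" and \<epsilon> C lam :: real
  assumes "open I" and "is_interval I" and "I \<noteq> {}"
    and "smooth_real_on I f" and "smooth_real_on I g" and "smooth_real_on I \<rho>"
    and "\<forall>u\<in>I. \<rho> u > 0"
    and "(arclength_parametrized I (SR3_curve f g \<rho>) \<and> X = SR3_surface f g \<rho>) \<or>
         (arclength_parametrized I (SR4_curve f g \<rho>) \<and> X = SR4_surface f g \<rho>)"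
    and "\<epsilon> \<in> {1, -1}"
    and "\<forall>u\<in>I. \<forall>v. sgn (induced_metric X (vector [u, v]) $ 1 $ 1) = \<epsilon>"
    and "\<epsilon> * C = - lam\<^sup>2 \<or> \<epsilon> * C = lam\<^sup>2"
  shows "(\<forall>u\<in>I. \<forall>v. gaussian_curvature X (vector [u, v]) = C) \<longleftrightarrow>
    (\<exists>C1 C2. \<forall>u\<in>I.
       (\<epsilon> * C = - lam\<^sup>2 \<and> - lam\<^sup>2 < 0 \<longrightarrow> \<rho> u = C1 * exp (lam * u) + C2 * exp (- lam * u)) \<and>
       (\<epsilon> * C = lam\<^sup>2 \<and> lam\<^sup>2 > 0 \<longrightarrow> \<rho> u = C1 * sin (lam * u) + C2 * cos (lam * u)) \<and>
       (C = 0 \<longrightarrow> \<rho> u = C1 * u + C2))"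
proof -
  note I = \<open>open I\<close> \<open>is_interval I\<close>
  note Df = smooth_real_on_DERIV[OF assms(4)]
  note Dg = smooth_real_on_DERIV[OF assms(5)]
  note D\<rho> = smooth_real_on_DERIV[OF assms(6)]
  let ?r'' = "deriv (deriv \<rho>)"
  have \<rho>0: "\<rho> u \<noteq> 0" if "u \<in> I" for u
    using assms(7) that by fastforce
  have \<epsilon>0: "\<epsilon> \<noteq> 0"
    using assms(9) by auto
  obtain z where metric: "\<And>q. q $ 1 \<in> I \<Longrightarrow> induced_metric X q = diag2
        (lorentz (vector_derivative z (at (q $ 1))) (vector_derivative z (at (q $ 1))))
        ((\<rho> (q $ 1))\<^sup>2)"
    and z: "arclength_parametrized I z"
    using assms(8) induced_metric_SR3[OF Df(1) Dg(1) D\<rho>(1)]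
      induced_metric_SR4[OF Df(1) Dg(1) D\<rho>(1)] by blast
  have "lorentz (vector_derivative z (at u)) (vector_derivative z (at u)) = \<epsilon>"
    if u: "u \<in> I" for u
  proof -
    have "sgn (induced_metric X (vector [u, 0]) $ 1 $ 1) = \<epsilon>"
      using assms(10) u by blast
    then have "sgn (lorentz (vector_derivative z (at u)) (vector_derivative z (at u))) = \<epsilon>"
      using metric[of "vector [u, 0]"] u by simp
    then show ?thesis
      using z u by (auto simp: arclength_parametrized_def)
  qed
  then have h: "induced_metric X q = diag2 \<epsilon> ((\<rho> (q $ 1))\<^sup>2)" if "q $ 1 \<in> I" for q
    using metric that by simp
  have K: "gaussian_curvature X (vector [u, v]) = - ?r'' u / (\<epsilon> * \<rho> u)" if "u \<in> I" for u v
    using sectional_curvature_warped[OF I(1) \<epsilon>0 h \<rho>0 D\<rho>, of "vector [u, v]"] that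
    by (simp add: gaussian_curvature_def)
  \<comment> \<open>The factor \<open>\<epsilon>\<close> may change sides because \<open>\<epsilon>\<^sup>2 = 1\<close>.\<close>
  have "gaussian_curvature X (vector [u, v]) = C \<longleftrightarrow> ?r'' u = - (\<epsilon> * C) * \<rho> u"
    if "u \<in> I" for u v
    using \<rho>0[OF that] assms(9) by (auto simp: K[OF that] field_simps)
  then have curv: "(\<forall>u\<in>I. \<forall>v. gaussian_curvature X (vector [u, v]) = C) \<longleftrightarrow>
      (\<forall>u\<in>I. ?r'' u = - (\<epsilon> * C) * \<rho> u)"
    by simp
  show ?thesis
  proof (cases "lam = 0")
    case True
    then have "C = 0" using assms(11) \<epsilon>0 by simp
    then show ?thesis
      using ode_affine_iff[OF I D\<rho>] True unfolding curv by simp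
  next
    case False
    then have pos: "lam\<^sup>2 > 0" by simp
    with assms(11) have "C \<noteq> 0" by auto
    from assms(11) show ?thesis
    proof
      assume "\<epsilon> * C = - lam\<^sup>2"
      then show ?thesis
        using ode_exp_iff[OF I False D\<rho>] pos \<open>C \<noteq> 0\<close> unfolding curv by simp
    next
      assume "\<epsilon> * C = lam\<^sup>2"
      then show ?thesis
        using ode_sin_cos_iff[OF I False D\<rho>] pos \<open>C \<noteq> 0\<close> unfolding curv by simp
    qed
  qed
qed

end
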